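(* Let $(M',J')$ be an almost complex manifold, let $(M_1,g_1,J_1)$ be a metallic Riemannian manifold, and let $F:M'\to M_1$ be a smooth map such that $F_*J'=J_1F_*$. Then $F$ is a constant map.
   Context: All manifolds and maps are $C^\infty$; $F_*$ is the differential of $F$. A metallic Riemannian manifold $(M,g,J)$ is a Riemannian manifold $(M,g)$ with a $(1,1)$-tensor field $J$ such that $J^2=pJ+qI$ for some positive integers $p,q$ ($I$ the identity) and $g(JX,Y)=g(X,JY)$ for all vector fields $X,Y$; it is assumed throughout that $\nabla J=0$ for the Levi-Civita connection $\nabla$ of $g$. An almost complex manifold $(M',J')$ is a $2n$-dimensional real manifold with a tensor field $J':TM'\to TM'$ such that $J'^2=-I$.
   Formalization: The manifold M' is additionally assumed connected; without this F need only be locally constant (e.g. two disjoint copies of the complex plane sent to two different points). Manifolds are taken of dimension at least 1. *)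

theory Defs
  imports "HOL-Analysis.Analysis"
begin

section \<open>Smooth functions between Euclidean spaces\<close>

text \<open>
  To be used for open \<open>S\<close> and finite-dimensional domains, where being $C^{k+1}$ means being
  differentiable with all directional derivatives of class $C^k$.
\<close>

primrec Ck_on ::
    "nat \<Rightarrow> 'e::euclidean_space set \<Rightarrow> ('e \<Rightarrow> 'f::real_normed_vector) \<Rightarrow> bool" where
  "Ck_on 0 S f \<longleftrightarrow> continuous_on S f"
| "Ck_on (Suc k) S f \<longleftrightarrow>
     (\<forall>x\<in>S. f differentiable (at x)) \<and>
     (\<forall>v. Ck_on k S (\<lambda>x. frechet_derivative f (at x) v))"

definition smooth_on :: "'e::euclidean_space set \<Rightarrow> ('e \<Rightarrow> 'f::real_normed_vector) \<Rightarrow> bool" where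
  "smooth_on S f \<longleftrightarrow> (\<forall>k. Ck_on k S f)"

section \<open>Smooth manifolds\<close>

text \<open>
  A chart is a pair of its domain and its coordinate map; values of the coordinate map outside the
  domain are irrelevant. The charts form an atlas that need not be maximal. More generally, maps,
  fields and tensors on a manifold are total functions of which only the values at points of the
  underlying space matter.
\<close>

record ('a, 'e) manifold =
  space_of :: "'a topology"
  charts :: "('a set \<times> ('a \<Rightarrow> 'e)) set"

abbreviation points :: "('a, 'e) manifold \<Rightarrow> 'a set" where
  "points M \<equiv> topspace (space_of M)"

definition smooth_manifold :: "('a, 'e::euclidean_space) manifold \<Rightarrow> bool" where
  "smooth_manifold M \<longleftrightarrow>
     Hausdorff_space (space_of M) \<and>
     second_countable (space_of M) \<and>
     points M = (\<Union>(U, \<phi>)\<in>charts M. U) \<and>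
     (\<forall>(U, \<phi>)\<in>charts M.
        openin (space_of M) U \<and> open (\<phi> ` U) \<and>
        homeomorphic_map (subtopology (space_of M) U) (top_of_set (\<phi> ` U)) \<phi>) \<and>
     (\<forall>(U, \<phi>)\<in>charts M. \<forall>(V, \<psi>)\<in>charts M.
        smooth_on (\<phi> ` (U \<inter> V)) (\<psi> \<circ> inv_into U \<phi>))"

definition smooth_map ::
    "('a, 'e::euclidean_space) manifold \<Rightarrow> ('b, 'f::euclidean_space) manifold \<Rightarrow> ('a \<Rightarrow> 'b) \<Rightarrow> bool" where
  "smooth_map M N F \<longleftrightarrow>
     continuous_map (space_of M) (space_of N) F \<and>
     (\<forall>(U, \<phi>)\<in>charts M. \<forall>(V, \<psi>)\<in>charts N.
        smooth_on (\<phi> ` {x \<in> U. F x \<in> V}) (\<psi> \<circ> F \<circ> inv_into U \<phi>))"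

text \<open>Real-valued functions that are smooth on an open set \<open>W\<close>, resp. on some neighbourhood of a point:\<close>

definition smooth_fun_on ::
    "('a, 'e::euclidean_space) manifold \<Rightarrow> 'a set \<Rightarrow> ('a \<Rightarrow> real) \<Rightarrow> bool" where
  "smooth_fun_on M W f \<longleftrightarrow>
     (\<forall>(U, \<phi>)\<in>charts M. smooth_on (\<phi> ` (U \<inter> W)) (f \<circ> inv_into U \<phi>))"

definition smooth_near ::
    "('a, 'e::euclidean_space) manifold \<Rightarrow> 'a \<Rightarrow> ('a \<Rightarrow> real) \<Rightarrow> bool" where
  "smooth_near M x f \<longleftrightarrow> (\<exists>W. openin (space_of M) W \<and> x \<in> W \<and> smooth_fun_on M W f)"

section \<open>Tangent vectors and vector fields\<close>

text \<open>
  A tangent vector at \<open>x\<close> is a derivation of the algebra of germs at \<open>x\<close> of smooth functions,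
  represented as a functional on functions that depends only on their germ at \<open>x\<close>. It is set to
  \<open>0\<close> on functions that are not smooth near \<open>x\<close>, which makes the representation unique.
\<close>

type_synonym 'a tvec = "('a \<Rightarrow> real) \<Rightarrow> real"

definition tangent_space :: "('a, 'e::euclidean_space) manifold \<Rightarrow> 'a \<Rightarrow> 'a tvec set" where
  "tangent_space M x = {v.
     (\<forall>f. \<not> smooth_near M x f \<longrightarrow> v f = 0) \<and>
     (\<forall>f g. smooth_near M x f \<and> smooth_near M x g \<and>
        (\<exists>W. openin (space_of M) W \<and> x \<in> W \<and> (\<forall>y\<in>W. f y = g y)) \<longrightarrow> v f = v g) \<and>
     (\<forall>f g. smooth_near M x f \<and> smooth_near M x g \<longrightarrow>
        v (\<lambda>y. f y + g y) = v f + v g \<and>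
        v (\<lambda>y. f y * g y) = f x * v g + g x * v f) \<and>
     (\<forall>c f. smooth_near M x f \<longrightarrow> v (\<lambda>y. c * f y) = c * v f)}"

definition tadd :: "'a tvec \<Rightarrow> 'a tvec \<Rightarrow> 'a tvec" where
  "tadd u v = (\<lambda>f. u f + v f)"

definition tscale :: "real \<Rightarrow> 'a tvec \<Rightarrow> 'a tvec" where
  "tscale c v = (\<lambda>f. c * v f)"

text \<open>The differential \<open>F\<^sub>*\<close> at the point \<open>x\<close>:\<close>

definition differential ::
    "('b, 'f::euclidean_space) manifold \<Rightarrow> ('a \<Rightarrow> 'b) \<Rightarrow> 'a \<Rightarrow> 'a tvec \<Rightarrow> 'b tvec" where
  "differential N F x v = (\<lambda>f. if smooth_near N (F x) f then v (f \<circ> F) else 0)"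

definition vector_fields_on ::
    "('a, 'e::euclidean_space) manifold \<Rightarrow> 'a set \<Rightarrow> ('a \<Rightarrow> 'a tvec) set" where
  "vector_fields_on M U = {X.
     (\<forall>x\<in>U. X x \<in> tangent_space M x) \<and>
     (\<forall>W f. openin (space_of M) W \<and> W \<subseteq> U \<and> smooth_fun_on M W f \<longrightarrow>
        smooth_fun_on M W (\<lambda>x. X x f))}"

abbreviation vector_fields :: "('a, 'e::euclidean_space) manifold \<Rightarrow> ('a \<Rightarrow> 'a tvec) set" where
  "vector_fields M \<equiv> vector_fields_on M (points M)"

definition lie_bracket ::
    "('a, 'e::euclidean_space) manifold \<Rightarrow> ('a \<Rightarrow> 'a tvec) \<Rightarrow> ('a \<Rightarrow> 'a tvec) \<Rightarrow> 'a \<Rightarrow> 'a tvec" where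
  "lie_bracket M X Y x =
     (\<lambda>f. if smooth_near M x f then X x (\<lambda>y. Y y f) - Y x (\<lambda>y. X y f) else 0)"

section \<open>Tensor fields, metrics and connections\<close>

text \<open>
  Smoothness of tensor fields is expressed by their action on smooth vector fields defined on
  arbitrary open subsets.
\<close>

definition tensor_field_11 ::
    "('a, 'e::euclidean_space) manifold \<Rightarrow> ('a \<Rightarrow> 'a tvec \<Rightarrow> 'a tvec) \<Rightarrow> bool" where
  "tensor_field_11 M J \<longleftrightarrow>
     (\<forall>x\<in>points M. \<forall>u\<in>tangent_space M x. \<forall>v\<in>tangent_space M x. \<forall>c.
        J x u \<in> tangent_space M x \<and>
        J x (tadd u v) = tadd (J x u) (J x v) \<and>
        J x (tscale c u) = tscale c (J x u)) \<and>
     (\<forall>U. openin (space_of M) U \<longrightarrow>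
        (\<forall>X\<in>vector_fields_on M U. (\<lambda>x. J x (X x)) \<in> vector_fields_on M U))"

definition riemannian_metric ::
    "('a, 'e::euclidean_space) manifold \<Rightarrow> ('a \<Rightarrow> 'a tvec \<Rightarrow> 'a tvec \<Rightarrow> real) \<Rightarrow> bool" where
  "riemannian_metric M g \<longleftrightarrow>
     (\<forall>x\<in>points M. \<forall>u\<in>tangent_space M x. \<forall>v\<in>tangent_space M x. \<forall>w\<in>tangent_space M x. \<forall>c.
        g x u v = g x v u \<and>
        g x (tadd u v) w = g x u w + g x v w \<and>
        g x (tscale c u) v = c * g x u v \<and>
        (u \<noteq> (\<lambda>f. 0) \<longrightarrow> g x u u > 0)) \<and>
     (\<forall>U. openin (space_of M) U \<longrightarrow>
        (\<forall>X\<in>vector_fields_on M U. \<forall>Y\<in>vector_fields_on M U.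
           smooth_fun_on M U (\<lambda>x. g x (X x) (Y x))))"

definition affine_connection ::
    "('a, 'e::euclidean_space) manifold \<Rightarrow>
     (('a \<Rightarrow> 'a tvec) \<Rightarrow> ('a \<Rightarrow> 'a tvec) \<Rightarrow> 'a \<Rightarrow> 'a tvec) \<Rightarrow> bool" where
  "affine_connection M D \<longleftrightarrow>
     (\<forall>X\<in>vector_fields M. \<forall>Y\<in>vector_fields M. D X Y \<in> vector_fields M) \<and>
     (\<forall>X\<in>vector_fields M. \<forall>Y\<in>vector_fields M. \<forall>Z\<in>vector_fields M.
        \<forall>f. smooth_fun_on M (points M) f \<longrightarrow> (\<forall>x\<in>points M.
          D (\<lambda>y. tadd (X y) (Y y)) Z x = tadd (D X Z x) (D Y Z x) \<and>
          D (\<lambda>y. tscale (f y) (X y)) Z x = tscale (f x) (D X Z x) \<and>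
          D X (\<lambda>y. tadd (Y y) (Z y)) x = tadd (D X Y x) (D X Z x) \<and>
          D X (\<lambda>y. tscale (f y) (Y y)) x = tadd (tscale (X x f) (Y x)) (tscale (f x) (D X Y x))))"

definition levi_civita_connection ::
    "('a, 'e::euclidean_space) manifold \<Rightarrow> ('a \<Rightarrow> 'a tvec \<Rightarrow> 'a tvec \<Rightarrow> real) \<Rightarrow>
     (('a \<Rightarrow> 'a tvec) \<Rightarrow> ('a \<Rightarrow> 'a tvec) \<Rightarrow> 'a \<Rightarrow> 'a tvec) \<Rightarrow> bool" where
  "levi_civita_connection M g D \<longleftrightarrow>
     affine_connection M D \<and>
     (\<forall>X\<in>vector_fields M. \<forall>Y\<in>vector_fields M. \<forall>x\<in>points M.
        D X Y x = tadd (D Y X x) (lie_bracket M X Y x)) \<and>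
     (\<forall>X\<in>vector_fields M. \<forall>Y\<in>vector_fields M. \<forall>Z\<in>vector_fields M. \<forall>x\<in>points M.
        X x (\<lambda>y. g y (Y y) (Z y)) = g x (D X Y x) (Z x) + g x (Y x) (D X Z x))"

text \<open>\<open>\<nabla>J = 0\<close>, i.e. $(\nabla_X J) Y = \nabla_X (J Y) - J (\nabla_X Y)$ vanishes:\<close>

definition parallel_11 ::
    "('a, 'e::euclidean_space) manifold \<Rightarrow>
     (('a \<Rightarrow> 'a tvec) \<Rightarrow> ('a \<Rightarrow> 'a tvec) \<Rightarrow> 'a \<Rightarrow> 'a tvec) \<Rightarrow> ('a \<Rightarrow> 'a tvec \<Rightarrow> 'a tvec) \<Rightarrow> bool" where
  "parallel_11 M D J \<longleftrightarrow>
     (\<forall>X\<in>vector_fields M. \<forall>Y\<in>vector_fields M. \<forall>x\<in>points M.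
        D X (\<lambda>y. J y (Y y)) x = J x (D X Y x))"

section \<open>Almost complex and metallic Riemannian manifolds\<close>

definition almost_complex_manifold ::
    "('a, 'e::euclidean_space) manifold \<Rightarrow> ('a \<Rightarrow> 'a tvec \<Rightarrow> 'a tvec) \<Rightarrow> bool" where
  "almost_complex_manifold M J \<longleftrightarrow>
     smooth_manifold M \<and>
     (\<exists>n. DIM('e) = 2 * n) \<and>
     tensor_field_11 M J \<and>
     (\<forall>x\<in>points M. \<forall>v\<in>tangent_space M x. J x (J x v) = tscale (-1) v)"

definition metallic_riemannian_manifold ::
    "('a, 'e::euclidean_space) manifold \<Rightarrow> ('a \<Rightarrow> 'a tvec \<Rightarrow> 'a tvec \<Rightarrow> real) \<Rightarrow>
     ('a \<Rightarrow> 'a tvec \<Rightarrow> 'a tvec) \<Rightarrow> bool" where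
  "metallic_riemannian_manifold M g J \<longleftrightarrow>
     smooth_manifold M \<and>
     riemannian_metric M g \<and>
     tensor_field_11 M J \<and>
     (\<exists>p q :: nat. p > 0 \<and> q > 0 \<and>
        (\<forall>x\<in>points M. \<forall>v\<in>tangent_space M x.
           J x (J x v) = tadd (tscale (real p) (J x v)) (tscale (real q) v))) \<and>
     (\<forall>X\<in>vector_fields M. \<forall>Y\<in>vector_fields M. \<forall>x\<in>points M.
        g x (J x (X x)) (Y x) = g x (X x) (J x (Y x)))"

end

theory Submission
  imports Defs
begin

text \<open>
  For \<open>w = F\<^sub>* v\<close> the hypotheses give \<open>- w = J\<^sub>1\<^sup>2 w = p J\<^sub>1 w + q w\<close>, so \<open>w\<close> would be an eigenvector
  of \<open>J\<^sub>1\<close> with eigenvalue \<open>\<lambda> = - (q + 1) / p\<close>. But then \<open>\<lambda>\<^sup>2 = -1\<close>, which is impossible over the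
  reals unless \<open>w = 0\<close>. Hence \<open>F\<^sub>* = 0\<close>, and testing against coordinate functions shows that \<open>F\<close> is
  locally constant.
\<close>

section \<open>Calculus of smooth functions\<close>

lemma Ck_on_subset: "Ck_on k S f \<Longrightarrow> T \<subseteq> S \<Longrightarrow> Ck_on k T f"
  by (induction k arbitrary: f) (auto intro: continuous_on_subset)

text \<open>Openness of \<open>S\<close> turns agreement on \<open>S\<close> into agreement near
  each of its points, so the derivatives coincide on \<open>S\<close> and the induction passes to
  them.\<close>

lemma Ck_on_cong:
  assumes "open S" "Ck_on k S f" "\<And>x. x \<in> S \<Longrightarrow> f x = g x"
  shows "Ck_on k S g"
  using assms(2,3)
proof (induction k arbitrary: f g)
  case 0
  then show ?case by (metis Ck_on.simps(1) continuous_on_cong)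
next
  case (Suc k)
  have d: "(g has_derivative frechet_derivative f (at x)) (at x)" if "x \<in> S" for x
  proof -
    have "(f has_derivative frechet_derivative f (at x)) (at x)"
      using Suc.prems that by (simp add: frechet_derivative_works)
    then show ?thesis
      using has_derivative_transform_within_open[OF _ \<open>open S\<close> that] Suc.prems(2) by blast
  qed
  have "Ck_on k S (\<lambda>x. frechet_derivative g (at x) v)" for v
  proof (rule Suc.IH)
    show "Ck_on k S (\<lambda>x. frechet_derivative f (at x) v)" using Suc.prems by simp
    show "frechet_derivative f (at x) v = frechet_derivative g (at x) v" if "x \<in> S" for x
      using frechet_derivative_at[OF d[OF that]] by simp
  qed
  then show ?case using d by (auto simp: differentiable_def)
qed

text \<open>Uniqueness of derivatives lets an explicit formula \<open>f'\<close> replace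
  \<open>frechet_derivative\<close>, so a calculus rule only has to show that its derivative formula
  is C^k.\<close>

lemma Ck_on_SucI:
  assumes "open S" "\<And>x. x \<in> S \<Longrightarrow> (f has_derivative f' x) (at x)"
    and "\<And>v. Ck_on k S (\<lambda>x. f' x v)"
  shows "Ck_on (Suc k) S f"
proof -
  have "Ck_on k S (\<lambda>x. frechet_derivative f (at x) v)" for v
    by (rule Ck_on_cong[OF assms(1) assms(3)[of v]]) (simp add: frechet_derivative_at[OF assms(2)])
  then show ?thesis using assms(2) by (auto simp: differentiable_def)
qed

lemma Ck_on_SucD:
  assumes "Ck_on (Suc k) S f" "x \<in> S"
  shows "(f has_derivative frechet_derivative f (at x)) (at x)"
  using assms by (simp add: frechet_derivative_works)

text \<open>Order zero is continuity of differentiable functions; higher orders apply the claim to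
  directional derivatives. The product and chain rules use it because undifferentiated functions
  reappear in their formulas.\<close>

lemma Ck_on_Suc_imp: "Ck_on (Suc k) S f \<Longrightarrow> Ck_on k S f"
  by (induction k arbitrary: f)
     (auto intro: continuous_at_imp_continuous_on differentiable_imp_continuous_within)

lemma Ck_on_const: "Ck_on k S (\<lambda>x. c)"
  by (induction k arbitrary: c) auto

section \<open>Closure of C^k under linear maps, sums, products and composition\<close>

lemma Ck_on_bounded_linear:
  assumes "bounded_linear h" "open S" "Ck_on k S f"
  shows "Ck_on k S (\<lambda>x. h (f x))"
  using assms(3)
proof (induction k arbitrary: f)
  case 0
  then show ?case by (simp add: bounded_linear.continuous_on[OF assms(1)])
next
  case (Suc k)
  show ?case
  proof (rule Ck_on_SucI[OF assms(2)])
    \<comment> \<open>A linear \<open>h\<close> is its own derivative, so directional derivatives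
      again have the form \<open>h\<close> after a function and the induction closes.\<close>
    show "((\<lambda>x. h (f x)) has_derivative (\<lambda>v. h (frechet_derivative f (at x) v))) (at x)"
      if "x \<in> S" for x
      using bounded_linear.has_derivative[OF assms(1) Ck_on_SucD[OF Suc.prems that]] .
    show "Ck_on k S (\<lambda>x. h (frechet_derivative f (at x) v))" for v
      by (rule Suc.IH) (use Suc.prems in simp)
  qed
qed

lemma Ck_on_add:
  assumes "open S" "Ck_on k S f" "Ck_on k S g"
  shows "Ck_on k S (\<lambda>x. f x + g x)"
  using assms(2,3)
proof (induction k arbitrary: f g)
  case 0
  then show ?case by (simp add: continuous_on_add)
next
  case (Suc k)
  show ?case
  proof (rule Ck_on_SucI[OF assms(1)])
    show "((\<lambda>x. f x + g x) has_derivative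
        (\<lambda>v. frechet_derivative f (at x) v + frechet_derivative g (at x) v)) (at x)"
      if "x \<in> S" for x
      using has_derivative_add[OF Ck_on_SucD[OF Suc.prems(1) that] Ck_on_SucD[OF Suc.prems(2) that]] .
    show "Ck_on k S (\<lambda>x. frechet_derivative f (at x) v + frechet_derivative g (at x) v)" for v
      by (rule Suc.IH) (use Suc.prems in simp_all)
  qed
qed

lemma Ck_on_sum:
  assumes "open S" "finite B" "\<And>b. b \<in> B \<Longrightarrow> Ck_on k S (f b)"
  shows "Ck_on k S (\<lambda>x. \<Sum>b\<in>B. f b x)"
  using assms(2,3) by (induction B rule: finite_induct) (auto intro: Ck_on_const Ck_on_add assms(1))

text \<open>The Leibniz rule produces products of one factor with a derivative of the other; both
  are covered by the induction hypothesis because \<open>f\<close> and \<open>g\<close> are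
  generalized.\<close>

lemma Ck_on_mult:
  fixes f g :: "'e::euclidean_space \<Rightarrow> real"
  assumes "open S" "Ck_on k S f" "Ck_on k S g"
  shows "Ck_on k S (\<lambda>x. f x * g x)"
  using assms(2,3)
proof (induction k arbitrary: f g)
  case 0
  then show ?case by (simp add: continuous_on_mult)
next
  case (Suc k)
  show ?case
  proof (rule Ck_on_SucI[OF assms(1)])
    show "((\<lambda>x. f x * g x) has_derivative
        (\<lambda>v. f x * frechet_derivative g (at x) v + frechet_derivative f (at x) v * g x)) (at x)"
      if "x \<in> S" for x
      using has_derivative_mult[OF Ck_on_SucD[OF Suc.prems(1) that] Ck_on_SucD[OF Suc.prems(2) that]] .
    show "Ck_on k S (\<lambda>x. f x * frechet_derivative g (at x) v + frechet_derivative f (at x) v * g x)" for v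
      by (intro Ck_on_add assms(1) Suc.IH Ck_on_Suc_imp[OF Suc.prems(1)] Ck_on_Suc_imp[OF Suc.prems(2)])
         (use Suc.prems in simp_all)
  qed
qed

text \<open>The chain rule evaluates the derivative of \<open>g\<close> in a direction varying with
  \<open>x\<close>, while \<open>Ck_on\<close> speaks of fixed directions. Expanding in the basis
  gives coefficients times composites of fixed directional derivatives of \<open>g\<close> with
  \<open>f\<close>, to which the induction hypothesis applies since \<open>g\<close> is
  arbitrary.\<close>

lemma Ck_on_compose:
  fixes f :: "'e::euclidean_space \<Rightarrow> 'f::euclidean_space" and g :: "'f \<Rightarrow> real"
  assumes "open S" "Ck_on k S f" "Ck_on k T g" "f ` S \<subseteq> T"
  shows "Ck_on k S (\<lambda>x. g (f x))"
  using assms(2,3)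
proof (induction k arbitrary: g)
  case 0
  then show ?case using continuous_on_compose2[OF _ _ assms(4)] by simp
next
  case (Suc k)
  let ?f' = "\<lambda>x. frechet_derivative f (at x)" and ?g' = "\<lambda>y. frechet_derivative g (at y)"
  show ?case
  proof (rule Ck_on_SucI[OF assms(1)])
    show "((\<lambda>x. g (f x)) has_derivative (\<lambda>v. \<Sum>b\<in>Basis. (?f' x v \<bullet> b) * ?g' (f x) b)) (at x)"
      if "x \<in> S" for x
    proof -
      have g: "(g has_derivative ?g' (f x)) (at (f x))"
        using Ck_on_SucD[OF Suc.prems(2)] assms(4) that by blast
      have expand: "?g' (f x) w = (\<Sum>b\<in>Basis. (w \<bullet> b) * ?g' (f x) b)" for w
      proof -
        interpret linear "?g' (f x)" using has_derivative_linear[OF g] .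
        have "?g' (f x) (\<Sum>b\<in>Basis. (w \<bullet> b) *\<^sub>R b) = (\<Sum>b\<in>Basis. (w \<bullet> b) * ?g' (f x) b)"
          by (simp only: sum scale real_scaleR_def)
        then show ?thesis by (simp only: euclidean_representation)
      qed
      show ?thesis
        using has_derivative_compose[OF Ck_on_SucD[OF Suc.prems(1) that] g]
        by (rule has_derivative_eq_rhs) (rule ext, rule expand)
    qed
    show "Ck_on k S (\<lambda>x. \<Sum>b\<in>Basis. (?f' x v \<bullet> b) * ?g' (f x) b)" for v
      by (intro Ck_on_sum Ck_on_mult assms(1) Suc.IH Ck_on_Suc_imp[OF Suc.prems(1)]
          Ck_on_bounded_linear[OF bounded_linear_inner_left])
         (use Suc.prems in simp_all)
  qed
qed

lemma smooth_on_subset: "smooth_on S f \<Longrightarrow> T \<subseteq> S \<Longrightarrow> smooth_on T f"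
  using Ck_on_subset unfolding smooth_on_def by blast

lemma smooth_on_cong:
  "open S \<Longrightarrow> smooth_on S f \<Longrightarrow> (\<And>x. x \<in> S \<Longrightarrow> f x = g x) \<Longrightarrow> smooth_on S g"
  using Ck_on_cong unfolding smooth_on_def by blast

lemma smooth_on_has_derivative:
  "smooth_on S f \<Longrightarrow> x \<in> S \<Longrightarrow> (f has_derivative frechet_derivative f (at x)) (at x)"
  using Ck_on_SucD unfolding smooth_on_def by blast

section \<open>Charts and smooth functions on manifolds\<close>

lemma chart_facts:
  assumes "smooth_manifold M" "(U, \<phi>) \<in> charts M"
  shows chart_openin: "openin (space_of M) U"
    and chart_inj: "inj_on \<phi> U"
    and chart_homeo: "homeomorphic_map (subtopology (space_of M) U) (top_of_set (\<phi> ` U)) \<phi>"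
    and chart_open: "open (\<phi> ` U)"
proof -
  have "\<forall>(U, \<phi>)\<in>charts M. openin (space_of M) U \<and> open (\<phi> ` U) \<and>
      homeomorphic_map (subtopology (space_of M) U) (top_of_set (\<phi> ` U)) \<phi>"
    using assms(1) unfolding smooth_manifold_def by (elim conjE)
  from bspec[OF this assms(2)]
  show o: "openin (space_of M) U"
    and h: "homeomorphic_map (subtopology (space_of M) U) (top_of_set (\<phi> ` U)) \<phi>"
    and "open (\<phi> ` U)"
    by simp_all
  show "inj_on \<phi> U"
    using homeomorphic_imp_injective_map[OF h] openin_subset[OF o]
    by (simp add: topspace_subtopology inf.absorb2)
qed

lemma chart_image_open:
  assumes "smooth_manifold M" "(U, \<phi>) \<in> charts M" "openin (space_of M) W"
  shows "open (\<phi> ` (U \<inter> W))"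
proof -
  have "openin (subtopology (space_of M) U) (U \<inter> W)"
    by (simp add: assms(3) openin_subtopology_Int2)
  then have "openin (top_of_set (\<phi> ` U)) (\<phi> ` (U \<inter> W))"
    using homeomorphic_imp_open_map[OF chart_homeo[OF assms(1,2)]] by (simp add: open_map_def)
  then show ?thesis by (rule openin_open_trans[OF _ chart_open[OF assms(1,2)]])
qed

text \<open>A set open in the subspace \<open>U\<close> is open in the whole space because
  \<open>U\<close> is. This carries a Euclidean ball back to a neighbourhood on the
  manifold.\<close>

lemma chart_preimage_open:
  assumes "smooth_manifold M" "(U, \<phi>) \<in> charts M" "open B"
  shows "openin (space_of M) {x \<in> U. \<phi> x \<in> B}"
proof -
  have U: "topspace (subtopology (space_of M) U) = U"
    using openin_subset[OF chart_openin[OF assms(1,2)]] by (simp add: topspace_subtopology inf.absorb2)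
  have "openin (top_of_set (\<phi> ` U)) (\<phi> ` U \<inter> B)" using assms(3) by (rule openin_open_Int)
  from openin_continuous_map_preimage[OF homeomorphic_imp_continuous_map[OF chart_homeo[OF assms(1,2)]] this]
  have "openin (subtopology (space_of M) U) {x \<in> U. \<phi> x \<in> \<phi> ` U \<inter> B}"
    unfolding U .
  moreover have "{x \<in> U. \<phi> x \<in> \<phi> ` U \<inter> B} = {x \<in> U. \<phi> x \<in> B}" by blast
  ultimately show ?thesis using openin_trans_full[OF _ chart_openin[OF assms(1,2)]] by simp
qed

lemma chart_exists:
  assumes "smooth_manifold M" "x \<in> points M"
  obtains U \<phi> where "(U, \<phi>) \<in> charts M" "x \<in> U"
proof -
  have "points M = (\<Union>(U, \<phi>)\<in>charts M. U)"
    using assms(1) unfolding smooth_manifold_def by (elim conjE)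
  then show ?thesis using assms(2) that by auto
qed

section \<open>Smooth germs and their pullbacks\<close>

lemma smooth_fun_onD:
  "smooth_fun_on M W f \<Longrightarrow> (U, \<phi>) \<in> charts M \<Longrightarrow> smooth_on (\<phi> ` (U \<inter> W)) (f \<circ> inv_into U \<phi>)"
  unfolding smooth_fun_on_def by auto

lemma smooth_fun_onI:
  "(\<And>U \<phi>. (U, \<phi>) \<in> charts M \<Longrightarrow> smooth_on (\<phi> ` (U \<inter> W)) (f \<circ> inv_into U \<phi>)) \<Longrightarrow> smooth_fun_on M W f"
  unfolding smooth_fun_on_def by auto

lemma smooth_nearI:
  "openin (space_of M) W \<Longrightarrow> x \<in> W \<Longrightarrow> smooth_fun_on M W f \<Longrightarrow> smooth_near M x f"
  unfolding smooth_near_def by blast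

lemma smooth_mapD:
  assumes "smooth_map M N F"
  shows smooth_map_continuous: "continuous_map (space_of M) (space_of N) F"
    and smooth_map_charts: "(U, \<phi>) \<in> charts M \<Longrightarrow> (V, \<psi>) \<in> charts N \<Longrightarrow>
      smooth_on (\<phi> ` {x \<in> U. F x \<in> V}) (\<psi> \<circ> F \<circ> inv_into U \<phi>)"
  using assms unfolding smooth_map_def by auto

lemma smooth_fun_on_subset:
  assumes "smooth_fun_on M W f" "W' \<subseteq> W"
  shows "smooth_fun_on M W' f"
proof (rule smooth_fun_onI)
  fix U \<phi> assume "(U, \<phi>) \<in> charts M"
  from smooth_fun_onD[OF assms(1) this] show "smooth_on (\<phi> ` (U \<inter> W')) (f \<circ> inv_into U \<phi>)"
    by (rule smooth_on_subset) (use assms(2) in blast)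
qed

lemma smooth_fun_on_add_mult:
  assumes "smooth_manifold M" "openin (space_of M) W" "smooth_fun_on M W f" "smooth_fun_on M W g"
  shows "smooth_fun_on M W (\<lambda>y. f y + g y)" "smooth_fun_on M W (\<lambda>y. f y * g y)"
proof -
  have *: "smooth_on (\<phi> ` (U \<inter> W)) ((\<lambda>y. f y + g y) \<circ> inv_into U \<phi>)"
      "smooth_on (\<phi> ` (U \<inter> W)) ((\<lambda>y. f y * g y) \<circ> inv_into U \<phi>)" if U: "(U, \<phi>) \<in> charts M" for U \<phi>
  proof -
    note o = chart_image_open[OF assms(1) U assms(2)]
    have "Ck_on k (\<phi> ` (U \<inter> W)) (f \<circ> inv_into U \<phi>)" "Ck_on k (\<phi> ` (U \<inter> W)) (g \<circ> inv_into U \<phi>)" for k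
      using smooth_fun_onD[OF assms(3) U] smooth_fun_onD[OF assms(4) U] by (simp_all add: smooth_on_def)
    from Ck_on_add[OF o this] Ck_on_mult[OF o this]
    show "smooth_on (\<phi> ` (U \<inter> W)) ((\<lambda>y. f y + g y) \<circ> inv_into U \<phi>)"
      "smooth_on (\<phi> ` (U \<inter> W)) ((\<lambda>y. f y * g y) \<circ> inv_into U \<phi>)"
      by (simp_all add: smooth_on_def o_def)
  qed
  show "smooth_fun_on M W (\<lambda>y. f y + g y)" "smooth_fun_on M W (\<lambda>y. f y * g y)"
    by (rule smooth_fun_onI, rule *, assumption)+
qed

lemma smooth_fun_on_const: "smooth_fun_on M W (\<lambda>y. c)"
  by (auto simp: smooth_fun_on_def smooth_on_def o_def Ck_on_const)

lemma smooth_near_const: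
  "x \<in> points M \<Longrightarrow> smooth_near M x (\<lambda>y. c)"
  by (rule smooth_nearI[OF openin_topspace _ smooth_fun_on_const])

lemma smooth_near_add_mult:
  assumes "smooth_manifold M" "smooth_near M x f" "smooth_near M x g"
  shows smooth_near_add: "smooth_near M x (\<lambda>y. f y + g y)"
    and smooth_near_mult: "smooth_near M x (\<lambda>y. f y * g y)"
proof -
  obtain W W' where W: "openin (space_of M) W" "x \<in> W" "smooth_fun_on M W f"
      "openin (space_of M) W'" "x \<in> W'" "smooth_fun_on M W' g"
    using assms unfolding smooth_near_def by blast
  have o: "openin (space_of M) (W \<inter> W')" "x \<in> W \<inter> W'" using W by auto
  have "smooth_fun_on M (W \<inter> W') f" "smooth_fun_on M (W \<inter> W') g"
    using smooth_fun_on_subset W by blast+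
  note sm = smooth_fun_on_add_mult[OF assms(1) o(1) this]
  show "smooth_near M x (\<lambda>y. f y + g y)" "smooth_near M x (\<lambda>y. f y * g y)"
    by (rule smooth_nearI[OF o sm(1)], rule smooth_nearI[OF o sm(2)])
qed

lemma smooth_near_points: "smooth_near M x f \<Longrightarrow> x \<in> points M"
  unfolding smooth_near_def using openin_subset by blast

lemma smooth_near_has_derivative:
  assumes "(U, \<phi>) \<in> charts M" "x \<in> U" "smooth_near M x f"
  shows "((f \<circ> inv_into U \<phi>) has_derivative frechet_derivative (f \<circ> inv_into U \<phi>) (at (\<phi> x))) (at (\<phi> x))"
proof -
  obtain W where "x \<in> W" "smooth_fun_on M W f"
    using assms(3) unfolding smooth_near_def by blast
  then show ?thesis
    using smooth_on_has_derivative[OF smooth_fun_onD[OF _ assms(1)]] assms(2) by simp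
qed

text \<open>In any other chart a coordinate function is a transition map followed by a linear
  functional. These are the test functions that will detect the derivative of a map.\<close>

lemma smooth_near_coordinate:
  assumes M: "smooth_manifold M" "(V, \<psi>) \<in> charts M" "y \<in> V"
  shows "smooth_near M y (\<lambda>z. \<psi> z \<bullet> b)"
proof -
  have "smooth_on (\<phi> ` (U \<inter> V)) ((\<lambda>z. \<psi> z \<bullet> b) \<circ> inv_into U \<phi>)" if "(U, \<phi>) \<in> charts M" for U \<phi>
  proof -
    have "\<forall>(U, \<phi>)\<in>charts M. \<forall>(V, \<psi>)\<in>charts M. smooth_on (\<phi> ` (U \<inter> V)) (\<psi> \<circ> inv_into U \<phi>)"
      using M(1) unfolding smooth_manifold_def by (elim conjE)
    from bspec[OF this that] have "smooth_on (\<phi> ` (U \<inter> V)) (\<psi> \<circ> inv_into U \<phi>)"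
      using M(2) by auto
    moreover have "open (\<phi> ` (U \<inter> V))"
      using chart_image_open[OF M(1) that chart_openin[OF M(1,2)]] .
    ultimately have "Ck_on k (\<phi> ` (U \<inter> V)) (\<lambda>z. (\<psi> \<circ> inv_into U \<phi>) z \<bullet> b)" for k
      by (intro Ck_on_bounded_linear[OF bounded_linear_inner_left]) (simp_all only: smooth_on_def)
    then show ?thesis by (simp add: smooth_on_def o_def)
  qed
  then show ?thesis by (rule smooth_nearI[OF chart_openin[OF M(1,2)] M(3) smooth_fun_onI])
qed

text \<open>In charts, \<open>f\<close> after \<open>F\<close> is the local expression of
  \<open>f\<close> after that of \<open>F\<close>, so the Euclidean composition rule applies. It
  makes the differential meaningful on every smooth germ.\<close>

lemma smooth_near_compose:
  assumes M: "smooth_manifold M" and N: "smooth_manifold N" and F: "smooth_map M N F"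
    and x: "x \<in> points M" and f: "smooth_near N (F x) f"
  shows "smooth_near M x (f \<circ> F)"
proof -
  obtain W where W: "openin (space_of N) W" "F x \<in> W" "smooth_fun_on N W f"
    using f unfolding smooth_near_def by blast
  obtain V \<psi> where V: "(V, \<psi>) \<in> charts N" "F x \<in> V"
    using chart_exists[OF N smooth_near_points[OF f]] .
  \<comment> \<open>On this set \<open>F\<close> stays inside one chart of \<open>N\<close> and
    inside the region where \<open>f\<close> is known to be smooth.\<close>
  define W' where "W' = {z \<in> points M. F z \<in> V \<inter> W}"
  have cF: "continuous_map (space_of M) (space_of N) F" by (rule smooth_map_continuous[OF F])
  have oW': "openin (space_of M) W'"
    unfolding W'_def
    by (rule openin_continuous_map_preimage[OF cF openin_Int[OF chart_openin[OF N V(1)] W(1)]])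
  have "smooth_on (\<phi> ` (U \<inter> W')) ((f \<circ> F) \<circ> inv_into U \<phi>)" if U: "(U, \<phi>) \<in> charts M" for U \<phi>
  proof -
    have o: "open (\<phi> ` (U \<inter> W'))" by (rule chart_image_open[OF M U oW'])
    have inv: "inv_into U \<phi> (\<phi> z) = z" if "z \<in> U" for z
      using inv_into_f_f[OF chart_inj[OF M U] that] .
    have invV: "inv_into V \<psi> (\<psi> z) = z" if "z \<in> V" for z
      using inv_into_f_f[OF chart_inj[OF N V(1)] that] .
    have "smooth_on (\<phi> ` {z \<in> U. F z \<in> V}) (\<psi> \<circ> F \<circ> inv_into U \<phi>)"
      by (rule smooth_map_charts[OF F U V(1)])
    then have 1: "smooth_on (\<phi> ` (U \<inter> W')) (\<psi> \<circ> F \<circ> inv_into U \<phi>)"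
      by (rule smooth_on_subset) (auto simp: W'_def)
    have 2: "smooth_on (\<psi> ` (V \<inter> W)) (f \<circ> inv_into V \<psi>)"
      by (rule smooth_fun_onD[OF W(3) V(1)])
    have 3: "(\<psi> \<circ> F \<circ> inv_into U \<phi>) ` (\<phi> ` (U \<inter> W')) \<subseteq> \<psi> ` (V \<inter> W)"
      by (auto simp: W'_def inv)
    have "smooth_on (\<phi> ` (U \<inter> W')) (\<lambda>z. (f \<circ> inv_into V \<psi>) ((\<psi> \<circ> F \<circ> inv_into U \<phi>) z))"
      using Ck_on_compose[OF o _ _ 3] 1 2 unfolding smooth_on_def by blast
    \<comment> \<open>Both inverse charts cancel only over \<open>W'\<close>, which is why the two
      expressions are compared on this open image alone.\<close>
    then show ?thesis
      by (rule smooth_on_cong[OF o]) (auto simp: W'_def inv invV)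
  qed
  moreover have "x \<in> W'" using x W(2) V(2) by (simp add: W'_def)
  ultimately show ?thesis by (intro smooth_nearI[OF oW'] smooth_fun_onI)
qed

section \<open>Tangent vectors\<close>

text \<open>This is the partial derivative in direction \<open>e\<close> in the given chart; the
  value 0 on non-smooth functions is the normalization demanded by
  \<open>tangent_space\<close>.\<close>

definition coordinate_vector ::
    "('a, 'e::euclidean_space) manifold \<Rightarrow> 'a set \<Rightarrow> ('a \<Rightarrow> 'e) \<Rightarrow> 'a \<Rightarrow> 'e \<Rightarrow> 'a tvec" where
  "coordinate_vector M U \<phi> x e = (\<lambda>f. if smooth_near M x f
     then frechet_derivative (f \<circ> inv_into U \<phi>) (at (\<phi> x)) e else 0)"

lemma coordinate_vector_tangent:
  assumes M: "smooth_manifold M" and U: "(U, \<phi>) \<in> charts M" "x \<in> U"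
  shows "coordinate_vector M U \<phi> x e \<in> tangent_space M x"
proof -
  let ?i = "inv_into U \<phi>"
  let ?D = "\<lambda>f. frechet_derivative (f \<circ> ?i) (at (\<phi> x))"
  let ?v = "coordinate_vector M U \<phi> x e"
  have inv: "?i (\<phi> z) = z" if "z \<in> U" for z
    using inv_into_f_f[OF chart_inj[OF M U(1)] that] .
  have D: "((f \<circ> ?i) has_derivative ?D f) (at (\<phi> x))" if "smooth_near M x f" for f
    using smooth_near_has_derivative[OF U that] .
  \<comment> \<open>By uniqueness the vector can be evaluated with any derivative of the local
    expression, so the derivation laws reduce to the usual calculus rules.\<close>
  have v: "?v f = D' e" if "smooth_near M x f" "((f \<circ> ?i) has_derivative D') (at (\<phi> x))" for f D'
    using that frechet_derivative_at[OF that(2)] by (simp add: coordinate_vector_def)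
  have v': "?v f = ?D f e" if "smooth_near M x f" for f
    using that by (simp add: coordinate_vector_def)
  have x: "x \<in> points M" using openin_subset[OF chart_openin[OF M U(1)]] U(2) by blast
  have "?v f = ?v g"
    if f: "smooth_near M x f" and g: "smooth_near M x g"
      and W: "openin (space_of M) W" "x \<in> W" "\<forall>y\<in>W. f y = g y" for f g W
  proof -
    have "((g \<circ> ?i) has_derivative ?D f) (at (\<phi> x))"
      by (rule has_derivative_transform_within_open[OF D[OF f] chart_image_open[OF M U(1) W(1)]])
         (use W U(2) inv in auto)
    then show ?thesis using v[OF g] v'[OF f] by simp
  qed
  moreover have add: "?v (\<lambda>y. f y + g y) = ?v f + ?v g"
    if f: "smooth_near M x f" and g: "smooth_near M x g" for f g
    using v[OF smooth_near_add[OF M f g], of "\<lambda>e. ?D f e + ?D g e"]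
      has_derivative_add[OF D[OF f] D[OF g]] v'[OF f] v'[OF g] by (simp add: o_def)
  moreover have mult: "?v (\<lambda>y. f y * g y) = f x * ?v g + g x * ?v f"
    if f: "smooth_near M x f" and g: "smooth_near M x g" for f g
    using v[OF smooth_near_mult[OF M f g], of "\<lambda>e. f x * ?D g e + ?D f e * g x"]
      has_derivative_mult[OF D[OF f] D[OF g]] v'[OF f] v'[OF g] inv[OF U(2)] by (simp add: o_def)
  moreover have "?v (\<lambda>y. c * f y) = c * ?v f" if f: "smooth_near M x f" for c f
  proof -
    \<comment> \<open>Homogeneity comes from the Leibniz rule with a constant factor, whose own
      derivative vanishes.\<close>
    have "((\<lambda>y. c) \<circ> ?i has_derivative (\<lambda>_. 0)) (at (\<phi> x))" by (simp add: o_def)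
    from v[OF smooth_near_const[OF x] this] have "?v (\<lambda>y. c) = 0" .
    then show ?thesis using mult[OF smooth_near_const[OF x] f] by simp
  qed
  ultimately show ?thesis
    unfolding tangent_space_def by (auto simp: coordinate_vector_def[of M U \<phi> x e])
qed

text \<open>Pullback along \<open>F\<close> respects germs, sums, products and scalars, and
  evaluates at \<open>x\<close> as the original function does at \<open>F x\<close>. Composing a
  derivation with it therefore gives a derivation at \<open>F x\<close>.\<close>

lemma differential_tangent:
  assumes M: "smooth_manifold M" and N: "smooth_manifold N" and F: "smooth_map M N F"
    and x: "x \<in> points M" and v: "v \<in> tangent_space M x"
  shows "differential N F x v \<in> tangent_space N (F x)"
proof -
  note comp = smooth_near_compose[OF M N F x]
  have cF: "continuous_map (space_of M) (space_of N) F" by (rule smooth_map_continuous[OF F])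
  have Fx: "F x \<in> points N" using continuous_map_image_subset_topspace[OF cF] x by blast
  have d: "differential N F x v f = v (f \<circ> F)" if "smooth_near N (F x) f" for f
    using that by (simp add: differential_def)
  have v_add: "v (\<lambda>y. f y + g y) = v f + v g" and v_mult: "v (\<lambda>y. f y * g y) = f x * v g + g x * v f"
    and v_cong: "openin (space_of M) W \<Longrightarrow> x \<in> W \<Longrightarrow> (\<And>y. y \<in> W \<Longrightarrow> f y = g y) \<Longrightarrow> v f = v g"
    if "smooth_near M x f" "smooth_near M x g" for f g W
    using v that unfolding tangent_space_def by blast+
  have v_scale: "v (\<lambda>y. c * f y) = c * v f" if "smooth_near M x f" for c f
    using v that unfolding tangent_space_def by blast
  have "differential N F x v f = differential N F x v g"
    if f: "smooth_near N (F x) f" and g: "smooth_near N (F x) g"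
      and W: "openin (space_of N) W" "F x \<in> W" "\<forall>y\<in>W. f y = g y" for f g W
  proof -
    \<comment> \<open>Agreement on \<open>W\<close> pulls back to agreement on the preimage of
      \<open>W\<close>, which is open by continuity.\<close>
    have "v (f \<circ> F) = v (g \<circ> F)"
      by (rule v_cong[OF comp[OF f] comp[OF g] openin_continuous_map_preimage[OF cF W(1)]])
         (use x W in auto)
    then show ?thesis using d f g by simp
  qed
  moreover have "differential N F x v (\<lambda>y. f y + g y) = differential N F x v f + differential N F x v g"
    if f: "smooth_near N (F x) f" and g: "smooth_near N (F x) g" for f g
    using v_add[OF comp[OF f] comp[OF g]] d[OF smooth_near_add[OF N f g]] d[OF f] d[OF g]
    by (simp add: o_def)
  moreover have "differential N F x v (\<lambda>y. f y * g y) =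
      f (F x) * differential N F x v g + g (F x) * differential N F x v f"
    if f: "smooth_near N (F x) f" and g: "smooth_near N (F x) g" for f g
    using v_mult[OF comp[OF f] comp[OF g]] d[OF smooth_near_mult[OF N f g]] d[OF f] d[OF g]
    by (simp add: o_def)
  moreover have "differential N F x v (\<lambda>y. c * f y) = c * differential N F x v f"
    if f: "smooth_near N (F x) f" for c f
    using v_scale[OF comp[OF f]] d[OF smooth_near_mult[OF N smooth_near_const[OF Fx] f]] d[OF f]
    by (simp add: o_def)
  ultimately show ?thesis
    unfolding tangent_space_def by (auto simp: differential_def[of N F x v])
qed

section \<open>Maps with vanishing differential\<close>

text \<open>The components of the derivative of the local expression of \<open>F\<close> are values
  of the differential on coordinate vectors, tested against coordinate functions. They all vanish,
  so the local expression is constant on a ball.\<close>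

lemma locally_constant_if_differential_zero:
  assumes M: "smooth_manifold M" and N: "smooth_manifold N" and F: "smooth_map M N F"
    and zero: "\<And>x v. x \<in> points M \<Longrightarrow> v \<in> tangent_space M x \<Longrightarrow> differential N F x v = (\<lambda>f. 0)"
    and x: "x \<in> points M"
  obtains W where "openin (space_of M) W" "x \<in> W" "\<And>z. z \<in> W \<Longrightarrow> F z = F x"
proof -
  have cF: "continuous_map (space_of M) (space_of N) F" by (rule smooth_map_continuous[OF F])
  have Fx: "F x \<in> points N" using continuous_map_image_subset_topspace[OF cF] x by blast
  obtain V \<psi> where V: "(V, \<psi>) \<in> charts N" "F x \<in> V" using chart_exists[OF N Fx] .
  obtain U \<phi> where U: "(U, \<phi>) \<in> charts M" "x \<in> U" using chart_exists[OF M x] .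
  have UM: "U \<subseteq> points M" using openin_subset[OF chart_openin[OF M U(1)]] .
  have inv: "inv_into U \<phi> (\<phi> z) = z" if "z \<in> U" for z
    using inv_into_f_f[OF chart_inj[OF M U(1)] that] .
  let ?h = "\<psi> \<circ> F \<circ> inv_into U \<phi>"
  \<comment> \<open>The part of the chart image on which the local expression \<open>?h\<close>
    represents \<open>F\<close> in the chart \<open>V\<close>.\<close>
  define O' where "O' = \<phi> ` {z \<in> U. F z \<in> V}"
  have "{z \<in> U. F z \<in> V} = U \<inter> {z \<in> points M. F z \<in> V}" using UM by blast
  then have oO: "open O'"
    unfolding O'_def
    using chart_image_open[OF M U(1) openin_continuous_map_preimage[OF cF chart_openin[OF N V(1)]]]
    by simp
  have sm: "smooth_on O' ?h" unfolding O'_def by (rule smooth_map_charts[OF F U(1) V(1)])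
  have D0: "(?h has_derivative (\<lambda>e. 0)) (at y)" if "y \<in> O'" for y
  proof -
    obtain z where z: "y = \<phi> z" "z \<in> U" "F z \<in> V" using \<open>y \<in> O'\<close> by (auto simp: O'_def)
    have zM: "z \<in> points M" using UM z by blast
    have Dh: "(?h has_derivative frechet_derivative ?h (at y)) (at y)"
      using smooth_on_has_derivative[OF sm that] .
    have "frechet_derivative ?h (at y) e \<bullet> b = 0" for e b
    proof -
      let ?f = "\<lambda>w. \<psi> w \<bullet> b"
      have f: "smooth_near N (F z) ?f" by (rule smooth_near_coordinate[OF N V(1) z(3)])
      have "differential N F z (coordinate_vector M U \<phi> z e) ?f = 0"
        using zero[OF zM coordinate_vector_tangent[OF M U(1) z(2)]] by simp
      \<comment> \<open>Smoothness of \<open>?f\<close> at \<open>F z\<close> and of its pullback at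
        \<open>z\<close> excludes the default 0 in both definitions, so the vanishing really
        concerns the derivative.\<close>
      then have "frechet_derivative (?f \<circ> F \<circ> inv_into U \<phi>) (at y) e = 0"
        using f smooth_near_compose[OF M N F zM f]
        by (simp add: differential_def coordinate_vector_def z(1))
      moreover have "((?f \<circ> F \<circ> inv_into U \<phi>) has_derivative
          (\<lambda>e. frechet_derivative ?h (at y) e \<bullet> b)) (at y)"
        using has_derivative_inner_left[OF Dh, of b] by (simp only: o_def)
      from frechet_derivative_at[OF this]
      have "frechet_derivative ?h (at y) e \<bullet> b = frechet_derivative (?f \<circ> F \<circ> inv_into U \<phi>) (at y) e"
        by (rule fun_cong)
      ultimately show ?thesis by simp
    qed
    then have "frechet_derivative ?h (at y) e = 0" for e
      using inner_eq_zero_iff by blast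
    then show ?thesis by (intro has_derivative_eq_rhs[OF Dh] ext)
  qed
  have "\<phi> x \<in> O'" using U V by (auto simp: O'_def)
  then obtain r where r: "r > 0" "ball (\<phi> x) r \<subseteq> O'" using oO open_contains_ball by blast
  \<comment> \<open>A ball is chosen because convexity makes a zero derivative force
    constancy.\<close>
  have const: "?h y = ?h (\<phi> x)" if "y \<in> ball (\<phi> x) r" for y
  proof (rule has_derivative_zero_unique[OF convex_ball _ that])
    show "(?h has_derivative (\<lambda>h. 0)) (at w within ball (\<phi> x) r)" if "w \<in> ball (\<phi> x) r" for w
      by (rule has_derivative_at_withinI[OF D0[OF subsetD[OF r(2) that]]])
    show "\<phi> x \<in> ball (\<phi> x) r" using r by simp
  qed
  show thesis
  proof
    show "openin (space_of M) {z \<in> U. \<phi> z \<in> ball (\<phi> x) r}"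
      by (rule chart_preimage_open[OF M U(1) open_ball])
    show "x \<in> {z \<in> U. \<phi> z \<in> ball (\<phi> x) r}" using U r by simp
    show "F z = F x" if "z \<in> {z \<in> U. \<phi> z \<in> ball (\<phi> x) r}" for z
    proof -
      \<comment> \<open>Membership in \<open>O'\<close> only provides some \<open>z'\<close> with
        the same coordinates; injectivity of the chart identifies it with \<open>z\<close>. The
        resulting \<open>F z \<in> V\<close> allows cancelling \<open>\<psi>\<close>.\<close>
      have "\<phi> z \<in> O'" using that r by blast
      then obtain z' where "\<phi> z = \<phi> z'" "z' \<in> U" "F z' \<in> V" by (auto simp: O'_def)
      then have "F z \<in> V" using that inj_onD[OF chart_inj[OF M U(1)], of z z'] by auto
      moreover have "\<psi> (F z) = \<psi> (F x)" using const[of "\<phi> z"] that inv U(2) by simp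
      ultimately show ?thesis using inj_onD[OF chart_inj[OF N V(1)]] V(2) by blast
    qed
  qed
qed

text \<open>A level set of a locally constant map is both open and closed, so in a connected space a
  nonempty one is everything.\<close>

lemma locally_constant_imp_constant:
  assumes "connected_space X"
    and loc: "\<And>x. x \<in> topspace X \<Longrightarrow> \<exists>W. openin X W \<and> x \<in> W \<and> (\<forall>z\<in>W. F z = F x)"
  shows "F constant_on topspace X"
proof (cases "topspace X = {}")
  case False
  then obtain a where a: "a \<in> topspace X" by blast
  let ?A = "{x \<in> topspace X. F x = F a}"
  \<comment> \<open>Stated for every predicate on values so that it yields both the level set and
    its complement.\<close>
  have op: "openin X {x \<in> topspace X. P (F x)}" for P
  proof (subst openin_subopen, intro ballI)
    fix x assume x: "x \<in> {x \<in> topspace X. P (F x)}"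
    then obtain W where W: "openin X W" "x \<in> W" "\<forall>z\<in>W. F z = F x" using loc by blast
    have "W \<subseteq> {x \<in> topspace X. P (F x)}"
    proof
      fix z assume "z \<in> W"
      with W(3) have "F z = F x" by (rule bspec)
      then show "z \<in> {x \<in> topspace X. P (F x)}"
        using x \<open>z \<in> W\<close> openin_subset[OF W(1)] by auto
    qed
    then show "\<exists>W. openin X W \<and> x \<in> W \<and> W \<subseteq> {x \<in> topspace X. P (F x)}" using W by blast
  qed
  have "openin X ?A" by (rule op)
  moreover have "closedin X ?A"
  proof -
    have "topspace X - ?A = {x \<in> topspace X. F x \<noteq> F a}" by auto
    then show ?thesis unfolding closedin_def using op[of "\<lambda>y. y \<noteq> F a"] by auto
  qed
  ultimately have "?A = topspace X"
    using assms(1) a unfolding connected_space_clopen_in by blast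
  then show ?thesis unfolding constant_on_def by blast
qed (simp add: constant_on_def)

section \<open>Almost complex versus metallic structures\<close>

text \<open>The metallic relation at \<open>w\<close> and at \<open>J y w\<close> gives two linear
  equations in these two vectors, with positive determinant.\<close>

lemma metallic_square_neq_minus_id:
  assumes M: "metallic_riemannian_manifold M g J" and y: "y \<in> points M"
    and w: "w \<in> tangent_space M y" and sq: "J y (J y w) = tscale (-1) w"
  shows "w = (\<lambda>f. 0)"
proof -
  obtain p q :: nat where p: "p > 0"
    and J2: "\<And>v. v \<in> tangent_space M y \<Longrightarrow>
           J y (J y v) = tadd (tscale (real p) (J y v)) (tscale (real q) v)"
    using M y unfolding metallic_riemannian_manifold_def by blast
  have t: "tensor_field_11 M J" using M unfolding metallic_riemannian_manifold_def by blast
  have Jw: "J y w \<in> tangent_space M y" using t y w unfolding tensor_field_11_def by blast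
  have "J y (J y (J y w)) = tscale (-1) (J y w)"
    unfolding sq using t y Jw w unfolding tensor_field_11_def by blast
  then have 1: "- J y w f = - real p * w f + real q * J y w f" for f
    using J2[OF Jw] sq by (simp add: tadd_def tscale_def fun_eq_iff)
  have 2: "- w f = real p * J y w f + real q * w f" for f
    using J2[OF w] sq by (simp add: tadd_def tscale_def fun_eq_iff)
  have "w f = 0" for f
  proof -
    \<comment> \<open>Here \<open>1\<close> says that (q+1) J w = p w and \<open>2\<close> that
      (q+1) w = -p J w. Multiplying the latter by q+1 and substituting the former eliminates J
      w.\<close>
    have "((real q + 1)\<^sup>2 + (real p)\<^sup>2) * w f = 0"
      using 1[of f] 2[of f] by algebra
    moreover have "(real q + 1)\<^sup>2 + (real p)\<^sup>2 > 0" using p by (simp add: add_nonneg_pos)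
    ultimately show ?thesis by simp
  qed
  then show ?thesis by blast
qed

theorem theorem4p7:
  fixes M' :: "('a, 'e::euclidean_space) manifold"
    and J' :: "'a \<Rightarrow> 'a tvec \<Rightarrow> 'a tvec"
    and M1 :: "('b, 'f::euclidean_space) manifold"
    and g1 :: "'b \<Rightarrow> 'b tvec \<Rightarrow> 'b tvec \<Rightarrow> real"
    and J1 :: "'b \<Rightarrow> 'b tvec \<Rightarrow> 'b tvec"
    and nabla1 :: "('b \<Rightarrow> 'b tvec) \<Rightarrow> ('b \<Rightarrow> 'b tvec) \<Rightarrow> 'b \<Rightarrow> 'b tvec"
    and F :: "'a \<Rightarrow> 'b"
  assumes "almost_complex_manifold M' J'"
    and "connected_space (space_of M')"
    and "metallic_riemannian_manifold M1 g1 J1"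
    and "levi_civita_connection M1 g1 nabla1"
    and "parallel_11 M1 nabla1 J1"
    and "smooth_map M' M1 F"
    and "\<And>x v. x \<in> points M' \<Longrightarrow> v \<in> tangent_space M' x \<Longrightarrow>
           differential M1 F x (J' x v) = J1 (F x) (differential M1 F x v)"
  shows "F constant_on (points M')"
proof -
  have M: "smooth_manifold M'" using assms(1) unfolding almost_complex_manifold_def by blast
  have N: "smooth_manifold M1" using assms(3) unfolding metallic_riemannian_manifold_def by blast
  have cF: "continuous_map (space_of M') (space_of M1) F"
    by (rule smooth_map_continuous[OF assms(6)])
  have zero: "differential M1 F x v = (\<lambda>f. 0)" if x: "x \<in> points M'" and v: "v \<in> tangent_space M' x" for x v
  proof (rule metallic_square_neq_minus_id[where y = "F x", OF assms(3)])
    have J'v: "J' x v \<in> tangent_space M' x" "J' x (J' x v) = tscale (-1) v"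
      using assms(1) x v unfolding almost_complex_manifold_def tensor_field_11_def by blast+
    \<comment> \<open>Linearity in the vector also holds in the default branch, where both sides are
      0.\<close>
    have "differential M1 F x (tscale (-1) v) = tscale (-1) (differential M1 F x v)"
      by (auto simp: differential_def tscale_def)
    \<comment> \<open>The intertwining relation is used twice, at \<open>v\<close> and at
      \<open>J' x v\<close>, to move the square of \<open>J'\<close> across the
      differential.\<close>
    then show "J1 (F x) (J1 (F x) (differential M1 F x v)) = tscale (-1) (differential M1 F x v)"
      using assms(7)[OF x v] assms(7)[OF x J'v(1)] J'v(2) by simp
    show "F x \<in> points M1" using continuous_map_image_subset_topspace[OF cF] x by blast
    show "differential M1 F x v \<in> tangent_space M1 (F x)"
      by (rule differential_tangent[OF M N assms(6) x v])
  qed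
  show ?thesis
  proof (rule locally_constant_imp_constant[OF assms(2)])
    fix x assume x: "x \<in> points M'"
    obtain W where "openin (space_of M') W" "x \<in> W" "\<And>z. z \<in> W \<Longrightarrow> F z = F x"
      using locally_constant_if_differential_zero[OF M N assms(6) zero x] by blast
    then show "\<exists>W. openin (space_of M') W \<and> x \<in> W \<and> (\<forall>z\<in>W. F z = F x)" by blast
  qed
qed

end
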